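(* Let $d\geq 2$. The homogeneous prime ideal in $\mathbb{C}[m_0,\ldots,m_d]$ of the $d$th chi-squared moment variety $\mathcal{M}^{\chi}_{d}\subseteq\mathbb{P}^d$ is generated by the $2\times 2$ minors of the $(2\times d)$-matrix $$H_d^{\chi}=\begin{pmatrix} m_0 & m_1 & m_2-2m_1 & \cdots & \sum_{i=0}^{d-1} (-2)^{d-i-1}S_{d-1,i}m_i\\ m_1 & m_2-2m_1 & m_3 - 6m_2 + 4m_1 & \cdots & \sum_{i=0}^d (-2)^{d-i}S_{d,i}m_i \end{pmatrix},$$ whose $j$th column, for $1\le j\le d$, is $(y_{j-1},y_j)^\top$ with $y_j=\sum_{i=0}^{j}(-2)^{j-i}S_{j,i}m_i$. In particular, $\mathcal{M}^{\chi}_{d}$ is a rational normal curve.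
   Context: The moments of the chi-squared distribution are, as functions of its parameter $k$, $m_0=1$ and $m_i=k(k+2)\cdots(k+2i-2)$ for $i\ge1$. The moment variety $\mathcal{M}^{\chi}_d\subseteq\mathbb{P}^d$ is the Zariski closure of the image of $\mathbb{C}\to\mathbb{P}^d$, $k\mapsto[m_0(k):m_1(k):\cdots:m_d(k)]$. $S_{n,i}$ denotes the Stirling numbers of the second kind (so $S_{0,0}=1$ and $S_{n,0}=0$ for $n\ge1$). A rational normal curve in $\mathbb{P}^d$ is a curve projectively equivalent to the image of $\mathbb{P}^1\to\mathbb{P}^d$, $[s:t]\mapsto[s^d:s^{d-1}t:\cdots:t^d]$. *)

theory Defs
  imports
    "HOL-Library.Poly_Mapping"
    "HOL-Combinatorics.Stirling"
    "HOL-Algebra.Ideal"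
    "Jordan_Normal_Form.Determinant"
    "Jordan_Normal_Form.DL_Submatrix"
begin

section \<open>Polynomials in \<open>m\<^sub>0, \<dots>, m\<^sub>d\<close>\<close>

text \<open>
  Monomials are finitely supported exponent vectors on \<open>nat\<close>; the ring in the \<open>d + 1\<close>
  variables \<open>m\<^sub>0, \<dots>, m\<^sub>d\<close> is cut out of the ring in countably many variables by its carrier.
\<close>

type_synonym mpoly = "(nat \<Rightarrow>\<^sub>0 nat) \<Rightarrow>\<^sub>0 complex"

definition mvar :: "nat \<Rightarrow> mpoly" where
  "mvar i = Poly_Mapping.single (Poly_Mapping.single i 1) 1"

definition mconst :: "complex \<Rightarrow> mpoly" where
  "mconst c = Poly_Mapping.single 0 c"

definition mpoly_ring :: "nat \<Rightarrow> mpoly ring" where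
  "mpoly_ring d =
     \<lparr>carrier = {f. \<forall>\<mu>\<in>Poly_Mapping.keys f. Poly_Mapping.keys \<mu> \<subseteq> {0..d}},
      monoid.mult = (*), one = 1, zero = 0, add = (+)\<rparr>"

definition mdegree :: "(nat \<Rightarrow>\<^sub>0 nat) \<Rightarrow> nat" where
  "mdegree \<mu> = (\<Sum>i\<in>Poly_Mapping.keys \<mu>. Poly_Mapping.lookup \<mu> i)"

definition homogeneous :: "mpoly \<Rightarrow> bool" where
  "homogeneous f \<longleftrightarrow> (\<exists>n. \<forall>\<mu>\<in>Poly_Mapping.keys f. mdegree \<mu> = n)"

definition homogeneous_ideal :: "nat \<Rightarrow> mpoly set \<Rightarrow> bool" where
  "homogeneous_ideal d I \<longleftrightarrow>
     ideal I (mpoly_ring d) \<and> I = Idl\<^bsub>mpoly_ring d\<^esub> {f \<in> I. homogeneous f}"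

definition meval :: "mpoly \<Rightarrow> complex vec \<Rightarrow> complex" where
  "meval f v =
     (\<Sum>\<mu>\<in>Poly_Mapping.keys f. Poly_Mapping.lookup f \<mu> *
        (\<Prod>i\<in>Poly_Mapping.keys \<mu>. (v $ i) ^ Poly_Mapping.lookup \<mu> i))"


section \<open>Projective space and its Zariski topology\<close>

text \<open>
  A point of \<open>\<P>\<^sup>d\<close> is the set of all its homogeneous coordinate vectors, which are the
  nonzero vectors of a line in \<open>\<complex>\<^sup>d\<^sup>+\<^sup>1\<close>.
\<close>

definition proj_point :: "complex vec \<Rightarrow> complex vec set" where
  "proj_point v = {c \<cdot>\<^sub>v v | c. c \<noteq> 0}"

definition proj_space :: "nat \<Rightarrow> complex vec set set" where
  "proj_space d = proj_point ` (carrier_vec (d + 1) - {0\<^sub>v (d + 1)})"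

definition zero_locus :: "nat \<Rightarrow> mpoly set \<Rightarrow> complex vec set set" where
  "zero_locus d S = {P \<in> proj_space d. \<forall>f\<in>S. \<forall>v\<in>P. meval f v = 0}"

definition zariski_closed :: "nat \<Rightarrow> complex vec set set \<Rightarrow> bool" where
  "zariski_closed d Z \<longleftrightarrow>
     (\<exists>S \<subseteq> carrier (mpoly_ring d). (\<forall>f\<in>S. homogeneous f) \<and> Z = zero_locus d S)"

definition zariski_closure :: "nat \<Rightarrow> complex vec set set \<Rightarrow> complex vec set set" where
  "zariski_closure d X = \<Inter>{Z. zariski_closed d Z \<and> X \<subseteq> Z}"

text \<open>
  The vanishing condition is imposed on all homogeneous coordinate vectors of all points,
  so it makes sense for inhomogeneous \<open>f\<close> as well.
\<close>

definition vanishing_ideal :: "nat \<Rightarrow> complex vec set set \<Rightarrow> mpoly set" where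
  "vanishing_ideal d X = {f \<in> carrier (mpoly_ring d). \<forall>P\<in>X. \<forall>v\<in>P. meval f v = 0}"


section \<open>Rational normal curves\<close>

definition standard_rational_normal_curve :: "nat \<Rightarrow> complex vec set set" where
  "standard_rational_normal_curve d =
     {proj_point (vec (d + 1) (\<lambda>i. s ^ (d - i) * t ^ i)) | s t. (s, t) \<noteq> (0, 0)}"

definition projectively_equivalent ::
    "nat \<Rightarrow> complex vec set set \<Rightarrow> complex vec set set \<Rightarrow> bool" where
  "projectively_equivalent d X Y \<longleftrightarrow>
     X \<subseteq> proj_space d \<and> Y \<subseteq> proj_space d \<and>
     (\<exists>A \<in> carrier_mat (d + 1) (d + 1). invertible_mat A \<and>
        Y = (\<lambda>P. (\<lambda>v. A *\<^sub>v v) ` P) ` X)"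

definition rational_normal_curve :: "nat \<Rightarrow> complex vec set set \<Rightarrow> bool" where
  "rational_normal_curve d X \<longleftrightarrow>
     projectively_equivalent d (standard_rational_normal_curve d) X"


section \<open>The chi-squared moment variety\<close>

definition chi_moment :: "nat \<Rightarrow> complex \<Rightarrow> complex" where
  "chi_moment i k = (\<Prod>j<i. k + 2 * of_nat j)"

definition chi_moment_variety :: "nat \<Rightarrow> complex vec set set" where
  "chi_moment_variety d =
     zariski_closure d (range (\<lambda>k. proj_point (vec (d + 1) (\<lambda>i. chi_moment i k))))"

definition chi_form :: "nat \<Rightarrow> mpoly" where
  "chi_form j = (\<Sum>i=0..j. mconst ((-2) ^ (j - i) * of_nat (Stirling j i)) * mvar i)"

text \<open>Rows and columns are indexed from \<open>0\<close>: column \<open>c\<close> is \<open>(y\<^sub>c, y\<^sub>c\<^sub>+\<^sub>1)\<close>.\<close>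

definition chi_matrix :: "nat \<Rightarrow> mpoly mat" where
  "chi_matrix d = mat 2 d (\<lambda>(r, c). chi_form (c + r))"

definition two_minors :: "'a :: comm_ring_1 mat \<Rightarrow> 'a set" where
  "two_minors H =
     {det (submatrix H {r, r'} {c, c'}) | r r' c c'.
        r < r' \<and> r' < dim_row H \<and> c < c' \<and> c' < dim_col H}"

end

theory Submission
  imports Defs
begin

text \<open>
  Write \<open>y\<^sub>j\<close> for \<^term>\<open>chi_form j\<close>.
  Inverting the expansion of rising factorials, \<open>y\<^sub>j\<close> takes the value \<open>k ^ j\<close> at the moment
  vector with parameter \<open>k\<close>, and the \<open>y\<^sub>j\<close> are unitriangular in the \<open>m\<^sub>i\<close>. Hence in the
  coordinates \<open>y\<^sub>j\<close> the moment curve is the affine part of the standard rational normal curve.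
  Modulo the minors, a product of \<open>n\<close> of the \<open>y\<^sub>j\<close> depends only on \<open>n\<close> and on the sum \<open>w\<close> of
  the indices, so every polynomial is congruent to a linear combination of one standard
  monomial for each \<open>(n, w)\<close>. On the cone over the curve this monomial takes the value
  \<open>c ^ n * k ^ w\<close>, and these functions are linearly independent: a polynomial vanishing on the
  cone lies in the ideal generated by the minors.
\<close>

section \<open>Evaluation, homogeneity and the ring of polynomials\<close>

definition mmonom :: "(nat \<Rightarrow>\<^sub>0 nat) \<Rightarrow> complex vec \<Rightarrow> complex" where
  "mmonom \<mu> v = (\<Prod>i\<in>Poly_Mapping.keys \<mu>. (v $ i) ^ Poly_Mapping.lookup \<mu> i)"

text \<open>Indices outside the support contribute only powers with exponent 0. Widening to a common
  finite index set allows monomials with different supports to be compared factor by factor.\<close>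

lemma mmonom_superset:
  assumes "finite A" "Poly_Mapping.keys \<mu> \<subseteq> A"
  shows "mmonom \<mu> v = (\<Prod>i\<in>A. (v $ i) ^ Poly_Mapping.lookup \<mu> i)"
  unfolding mmonom_def using assms by (intro prod.mono_neutral_left) (auto simp: in_keys_iff)

lemma mmonom_zero [simp]: "mmonom 0 v = 1"
  by (simp add: mmonom_def)

lemma mmonom_add: "mmonom (\<mu> + \<nu>) v = mmonom \<mu> v * mmonom \<nu> v"
proof -
  let ?A = "Poly_Mapping.keys \<mu> \<union> Poly_Mapping.keys \<nu>"
  have "Poly_Mapping.keys (\<mu> + \<nu>) \<subseteq> ?A" by (rule Poly_Mapping.keys_add)
  then show ?thesis
    by (simp add: mmonom_superset[of ?A] lookup_add power_add prod.distrib)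
qed

lemma meval_superset:
  assumes "finite A" "Poly_Mapping.keys f \<subseteq> A"
  shows "meval f v = (\<Sum>\<mu>\<in>A. Poly_Mapping.lookup f \<mu> * mmonom \<mu> v)"
  unfolding meval_def mmonom_def using assms
  by (intro sum.mono_neutral_left) (auto simp: in_keys_iff)

lemma meval_single [simp]: "meval (Poly_Mapping.single \<mu> a) v = a * mmonom \<mu> v"
  by (subst meval_superset[of "{\<mu>}"]) auto

lemma meval_zero [simp]: "meval 0 v = 0"
  by (simp add: meval_def)

lemma meval_one [simp]: "meval 1 v = 1"
  using meval_single[of 0 1 v] by simp

lemma meval_const [simp]: "meval (mconst c) v = c"
  by (simp add: mconst_def)

lemma meval_var [simp]: "meval (mvar i) v = v $ i"
  by (simp add: mvar_def mmonom_def)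

lemma meval_add [simp]: "meval (f + g) v = meval f v + meval g v"
proof -
  let ?A = "Poly_Mapping.keys f \<union> Poly_Mapping.keys g"
  have "Poly_Mapping.keys (f + g) \<subseteq> ?A" by (rule Poly_Mapping.keys_add)
  then show ?thesis
    by (simp add: meval_superset[of ?A] lookup_add algebra_simps sum.distrib)
qed

lemma meval_sum [simp]: "meval (sum f A) v = (\<Sum>x\<in>A. meval (f x) v)"
  by (induction A rule: infinite_finite_induct) auto

lemma meval_uminus [simp]: "meval (- f) v = - meval f v"
  using meval_add[of f "- f" v] by (simp add: add_eq_0_iff)

lemma meval_diff [simp]: "meval (f - g) v = meval f v - meval g v"
  using meval_add[of f "- g" v] by simp

lemma mpoly_sum_terms:
  "f = (\<Sum>\<mu>\<in>Poly_Mapping.keys f. Poly_Mapping.single \<mu> (Poly_Mapping.lookup f \<mu>))"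
  for f :: mpoly
proof (rule poly_mapping_eqI)
  fix \<nu>
  have "(\<Sum>\<mu>\<in>Poly_Mapping.keys f. Poly_Mapping.lookup (Poly_Mapping.single \<mu> (Poly_Mapping.lookup f \<mu>)) \<nu>)
     = (\<Sum>\<mu>\<in>Poly_Mapping.keys f. if \<nu> = \<mu> then Poly_Mapping.lookup f \<nu> else 0)"
    by (intro sum.cong) (auto simp: lookup_single when_def)
  then show "Poly_Mapping.lookup f \<nu> = Poly_Mapping.lookup
      (\<Sum>\<mu>\<in>Poly_Mapping.keys f. Poly_Mapping.single \<mu> (Poly_Mapping.lookup f \<mu>)) \<nu>"
    by (simp add: lookup_sum in_keys_iff)
qed

lemma meval_mult [simp]: "meval (f * g) v = meval f v * meval g v"
proof -
  let ?t = "\<lambda>h :: mpoly. \<lambda>\<mu>. Poly_Mapping.single \<mu> (Poly_Mapping.lookup h \<mu>)"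
  have "f * g = (\<Sum>\<mu>\<in>Poly_Mapping.keys f. \<Sum>\<nu>\<in>Poly_Mapping.keys g. ?t f \<mu> * ?t g \<nu>)"
    by (metis (no_types) mpoly_sum_terms sum_product)
  then show ?thesis
    by (simp add: meval_superset[of "Poly_Mapping.keys f" f] meval_superset[of "Poly_Mapping.keys g" g]
        mult_single mmonom_add sum_product mult_ac)
qed

lemma mdegree_superset:
  assumes "finite A" "Poly_Mapping.keys \<mu> \<subseteq> A"
  shows "mdegree \<mu> = (\<Sum>i\<in>A. Poly_Mapping.lookup \<mu> i)"
  unfolding mdegree_def using assms by (intro sum.mono_neutral_left) (auto simp: in_keys_iff)

lemma mdegree_add: "mdegree (\<mu> + \<nu>) = mdegree \<mu> + mdegree \<nu>"
proof -
  let ?A = "Poly_Mapping.keys \<mu> \<union> Poly_Mapping.keys \<nu>"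
  have "Poly_Mapping.keys (\<mu> + \<nu>) \<subseteq> ?A" by (rule Poly_Mapping.keys_add)
  then show ?thesis
    by (simp add: mdegree_superset[of ?A] lookup_add sum.distrib)
qed

text \<open>Naming the degree is what makes sums tractable: adding homogeneous polynomials of
  different degrees destroys homogeneity.\<close>

definition homogeneous_of :: "nat \<Rightarrow> mpoly \<Rightarrow> bool" where
  "homogeneous_of n f \<longleftrightarrow> (\<forall>\<mu>\<in>Poly_Mapping.keys f. mdegree \<mu> = n)"

lemma homogeneous_iff: "homogeneous f \<longleftrightarrow> (\<exists>n. homogeneous_of n f)"
  by (simp add: homogeneous_def homogeneous_of_def)

lemma homogeneous_of_mult:
  "homogeneous_of m f \<Longrightarrow> homogeneous_of n g \<Longrightarrow> homogeneous_of (m + n) (f * g)"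
  unfolding homogeneous_of_def using Poly_Mapping.keys_mult[of f g] by (fastforce simp: mdegree_add)

lemma homogeneous_of_add:
  "homogeneous_of n f \<Longrightarrow> homogeneous_of n g \<Longrightarrow> homogeneous_of n (f + g)"
  unfolding homogeneous_of_def using Poly_Mapping.keys_add[of f g] by blast

lemma homogeneous_of_diff:
  "homogeneous_of n f \<Longrightarrow> homogeneous_of n g \<Longrightarrow> homogeneous_of n (f - g)"
  unfolding homogeneous_of_def by (metis in_keys_iff lookup_minus diff_self)

lemma homogeneous_of_sum:
  "(\<And>x. x \<in> A \<Longrightarrow> homogeneous_of n (f x)) \<Longrightarrow> homogeneous_of n (sum f A)"
  by (induction A rule: infinite_finite_induct)
    (simp_all add: homogeneous_of_add, simp_all add: homogeneous_of_def)

lemma homogeneous_of_var: "homogeneous_of 1 (mvar i)"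
  by (simp add: homogeneous_of_def mvar_def mdegree_def)

lemma homogeneous_of_const: "homogeneous_of 0 (mconst c)"
  by (simp add: homogeneous_of_def mconst_def mdegree_def)

lemma mpoly_ring_simps [simp]:
  "monoid.mult (mpoly_ring d) = (*)" "one (mpoly_ring d) = 1"
  "zero (mpoly_ring d) = 0" "add (mpoly_ring d) = (+)"
  by (simp_all add: mpoly_ring_def)

lemma mem_mpoly_ring:
  "f \<in> carrier (mpoly_ring d) \<longleftrightarrow> (\<forall>\<mu>\<in>Poly_Mapping.keys f. Poly_Mapping.keys \<mu> \<subseteq> {0..d})"
  by (simp add: mpoly_ring_def)

lemma mpoly_ring_const [simp]: "mconst c \<in> carrier (mpoly_ring d)"
  by (simp add: mem_mpoly_ring mconst_def)

lemma mpoly_ring_var: "i \<le> d \<Longrightarrow> mvar i \<in> carrier (mpoly_ring d)"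
  by (simp add: mem_mpoly_ring mvar_def)

lemma mpoly_ring_zero [simp]: "0 \<in> carrier (mpoly_ring d)"
  by (simp add: mem_mpoly_ring)

lemma mpoly_ring_one [simp]: "1 \<in> carrier (mpoly_ring d)"
  by (simp add: mem_mpoly_ring)

lemma mpoly_ring_add:
  "f \<in> carrier (mpoly_ring d) \<Longrightarrow> g \<in> carrier (mpoly_ring d) \<Longrightarrow> f + g \<in> carrier (mpoly_ring d)"
  unfolding mem_mpoly_ring using Poly_Mapping.keys_add[of f g] by blast

lemma mpoly_ring_mult:
  assumes "f \<in> carrier (mpoly_ring d)" "g \<in> carrier (mpoly_ring d)"
  shows "f * g \<in> carrier (mpoly_ring d)"
  unfolding mem_mpoly_ring
proof
  fix \<mu> assume "\<mu> \<in> Poly_Mapping.keys (f * g)"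
  then obtain \<alpha> \<beta> where "\<mu> = \<alpha> + \<beta>" "\<alpha> \<in> Poly_Mapping.keys f" "\<beta> \<in> Poly_Mapping.keys g"
    using Poly_Mapping.keys_mult[of f g] by blast
  with assms show "Poly_Mapping.keys \<mu> \<subseteq> {0..d}"
    using Poly_Mapping.keys_add[of \<alpha> \<beta>] unfolding mem_mpoly_ring by blast
qed

lemma mpoly_ring_uminus: "f \<in> carrier (mpoly_ring d) \<Longrightarrow> - f \<in> carrier (mpoly_ring d)"
  by (simp add: mem_mpoly_ring)

lemma mpoly_ring_diff:
  "f \<in> carrier (mpoly_ring d) \<Longrightarrow> g \<in> carrier (mpoly_ring d) \<Longrightarrow> f - g \<in> carrier (mpoly_ring d)"
  using mpoly_ring_add[of f d "- g"] by (simp add: mpoly_ring_uminus)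

lemma mpoly_ring_sum:
  "(\<And>x. x \<in> A \<Longrightarrow> f x \<in> carrier (mpoly_ring d)) \<Longrightarrow> sum f A \<in> carrier (mpoly_ring d)"
  by (induction A rule: infinite_finite_induct) (auto intro: mpoly_ring_add)

lemma cring_mpoly_ring: "cring (mpoly_ring d)"
proof (rule cringI)
  show "abelian_group (mpoly_ring d)"
    by (rule abelian_groupI)
      (auto simp: algebra_simps mpoly_ring_add intro: bexI[OF _ mpoly_ring_uminus])
  show "comm_monoid (mpoly_ring d)"
    by (rule comm_monoidI) (auto simp: algebra_simps mpoly_ring_mult)
qed (simp add: algebra_simps)

text \<open>A polynomial is a finite sum of terms, and a term of positive degree splits off one
  variable. Multiplying by a single variable at a time suits the later reduction, which absorbs one
  linear factor per step.\<close>

lemma mpoly_ring_induct [consumes 1, case_names const add var]: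
  assumes f: "f \<in> carrier (mpoly_ring d)"
    and const: "\<And>c. P (mconst c)"
    and add: "\<And>f g. P f \<Longrightarrow> P g \<Longrightarrow> P (f + g)"
    and var: "\<And>i f. i \<le> d \<Longrightarrow> P f \<Longrightarrow> P (mvar i * f)"
  shows "P f"
proof -
  have monom: "P (Poly_Mapping.single \<mu> c)"
    if \<mu>: "Poly_Mapping.keys \<mu> \<subseteq> {0..d}" and n: "mdegree \<mu> = n" for \<mu> c n
    using that
  proof (induction n arbitrary: \<mu>)
    case 0
    then have "\<mu> = 0"
      by (metis finite_keys in_keys_iff mdegree_def poly_mapping_eqI sum_eq_0_iff lookup_zero)
    then show ?case using const[of c] by (simp add: mconst_def)
  next
    case (Suc n)
    then obtain i where i: "i \<in> Poly_Mapping.keys \<mu>"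
      by (metis mdegree_def nat.distinct(1) sum.neutral)
    \<comment> \<open>The truncated subtraction is exact, because \<open>i\<close> lies in the
      support of the exponent.\<close>
    define \<nu> where "\<nu> = \<mu> - Poly_Mapping.single i 1"
    have \<mu>_eq: "\<mu> = Poly_Mapping.single i 1 + \<nu>"
      using i by (intro poly_mapping_eqI)
        (auto simp: \<nu>_def lookup_add lookup_minus lookup_single when_def in_keys_iff)
    have "Poly_Mapping.keys \<nu> \<subseteq> Poly_Mapping.keys \<mu>"
      by (auto simp: \<nu>_def in_keys_iff lookup_minus)
    moreover have "mdegree \<nu> = n"
      using Suc.prems(2) unfolding \<mu>_eq mdegree_add by (simp add: mdegree_def)
    ultimately have "P (Poly_Mapping.single \<nu> c)" using Suc by blast
    moreover have "Poly_Mapping.single \<mu> c = mvar i * Poly_Mapping.single \<nu> c"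
      by (simp add: \<mu>_eq mvar_def mult_single)
    ultimately show ?case using var i Suc.prems(1) by auto
  qed
  have "P (\<Sum>\<mu>\<in>A. Poly_Mapping.single \<mu> (Poly_Mapping.lookup f \<mu>))"
    if "finite A" "A \<subseteq> Poly_Mapping.keys f" for A
    using that
  proof (induction rule: finite_induct)
    case empty
    then show ?case using const[of 0] by (simp add: mconst_def)
  next
    case (insert \<mu> A)
    then show ?case using f monom add by (auto simp: mem_mpoly_ring)
  qed
  then show ?thesis by (metis mpoly_sum_terms finite_keys order_refl)
qed

section \<open>The minors and the moment curve\<close>

text \<open>With two rows the only admissible row pair is 0, 1, so a minor is determined by its pair
  of columns.\<close>

lemma two_minors_two_rows:
  assumes "dim_row H = 2"
  shows "two_minors H =
    {H $$ (0, c) * H $$ (1, c') - H $$ (0, c') * H $$ (1, c) | c c'. c < c' \<and> c' < dim_col H}"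
proof -
  have det: "det (submatrix H {0, 1} {c, c'})
      = H $$ (0, c) * H $$ (1, c') - H $$ (0, c') * H $$ (1, c)"
    if "c < c'" "c' < dim_col H" for c c'
  proof -
    let ?S = "submatrix H {0, 1} {c, c'}"
    have rows: "{i. i < dim_row H \<and> i \<in> {0, 1}} = {0, 1}" using assms by auto
    have cols: "{j. j < dim_col H \<and> j \<in> {c, c'}} = {c, c'}" using that by auto
    have S: "?S \<in> carrier_mat 2 2"
      unfolding carrier_mat_def mem_Collect_eq dim_submatrix rows cols using that by simp
    \<comment> \<open>A selected column is renumbered by the count of selected columns to its left,
      so \<open>c\<close> and \<open>c'\<close> become columns 0 and 1.\<close>
    have colcard: "card {a \<in> {c, c'}. a < c} = 0" "card {a \<in> {c, c'}. a < c'} = 1"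
    proof -
      have "{a \<in> {c, c'}. a < c} = {}" "{a \<in> {c, c'}. a < c'} = {c}" using that by auto
      then show "card {a \<in> {c, c'}. a < c} = 0" "card {a \<in> {c, c'}. a < c'} = 1"
        by (simp_all only: card.empty card_1_singleton_iff) auto
    qed
    have rowcard: "card {a \<in> {0, 1}. a < i} = i" if "i < 2" for i :: nat
    proof -
      have "{a \<in> {0, 1}. a < i} = {..<i}" using that by auto
      then show ?thesis by simp
    qed
    have entries: "?S $$ (i, 0) = H $$ (i, c)" "?S $$ (i, 1) = H $$ (i, c')" if "i < 2" for i
    proof -
      have "i \<in> {0, 1}" using that by auto
      then show "?S $$ (i, 0) = H $$ (i, c)" "?S $$ (i, 1) = H $$ (i, c')"
        using submatrix_index_card[of i H c "{0, 1}" "{c, c'}"]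
          submatrix_index_card[of i H c' "{0, 1}" "{c, c'}"]
        unfolding colcard rowcard[OF \<open>i < 2\<close>] using \<open>i < 2\<close> \<open>c < c'\<close> \<open>c' < dim_col H\<close> assms
        by simp_all
    qed
    have "det ?S = (\<Sum>j<2. ?S $$ (0, j) * cofactor ?S 0 j)"
      by (rule laplace_expansion_row[OF S]) simp
    also have "\<dots> = ?S $$ (0, 0) * ?S $$ (1, 1) - ?S $$ (0, 1) * ?S $$ (1, 0)"
    proof -
      have "mat_delete ?S 0 j \<in> carrier_mat 1 1" for j
        using mat_delete_carrier[OF S, of 0 j] by simp
      then show ?thesis
        using S by (simp add: cofactor_def det_single numeral_2_eq_2 mat_delete_def)
    qed
    finally show ?thesis using entries[of 0] entries[of 1] by simp
  qed
  have "two_minors H =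
      {det (submatrix H {0, 1} {c, c'}) | c c'. c < c' \<and> c' < dim_col H}"
  proof -
    have "(r < r' \<and> r' < dim_row H) = (r = 0 \<and> r' = 1)" for r r' using assms by auto
    then show ?thesis unfolding two_minors_def by (smt (verit) Collect_cong)
  qed
  then show ?thesis using det by (smt (verit) Collect_cong)
qed

lemma two_minors_chi_matrix:
  "two_minors (chi_matrix d) =
    {chi_form c * chi_form (Suc c') - chi_form c' * chi_form (Suc c) | c c'. c < c' \<and> c' < d}"
proof -
  have dim: "dim_row (chi_matrix d) = 2" "dim_col (chi_matrix d) = d"
    by (simp_all add: chi_matrix_def)
  have "f = chi_matrix d $$ (0, c) * chi_matrix d $$ (1, c') - chi_matrix d $$ (0, c') * chi_matrix d $$ (1, c)
        \<and> c < c' \<and> c' < dim_col (chi_matrix d)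
    \<longleftrightarrow> f = chi_form c * chi_form (Suc c') - chi_form c' * chi_form (Suc c) \<and> c < c' \<and> c' < d"
    for f c c'
    unfolding dim by (auto simp: chi_matrix_def)
  then show ?thesis unfolding two_minors_two_rows[OF dim(1)] by presburger
qed

section \<open>Values of the forms on the cone over the moment curve\<close>

lemma chi_moment_Suc: "chi_moment (Suc i) k = chi_moment i k * (k + 2 * of_nat i)"
  by (simp add: chi_moment_def)

text \<open>Multiplication by \<open>k\<close> sends the moment \<open>m_i\<close> to
  \<open>m_(i+1) - 2 i m_i\<close>. Applied to the expansion of \<open>k ^ j\<close>, this
  reproduces the Stirling recurrence \<open>S(j+1,i) = i S(j,i) + S(j,i-1)\<close> together with the
  powers of -2.\<close>

lemma sum_Stirling_chi_moment:
  "(\<Sum>i\<le>j. (-2) ^ (j - i) * of_nat (Stirling j i) * chi_moment i k) = k ^ j"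
proof (induction j)
  case 0
  then show ?case by (simp add: chi_moment_def)
next
  case (Suc j)
  define h where "h i = (-2) ^ (Suc j - i) * of_nat (i * Stirling j i) * chi_moment i k" for i
  define g where "g i = (-2) ^ (j - i) * of_nat (Stirling j i) * chi_moment (Suc i) k" for i
  have "(\<Sum>i\<le>Suc j. (-2) ^ (Suc j - i) * of_nat (Stirling (Suc j) i) * chi_moment i k)
      = (\<Sum>i\<le>j. h (Suc i) + g i)"
    by (subst sum.atMost_Suc_shift) (simp add: h_def g_def algebra_simps)
  \<comment> \<open>\<open>h\<close> and \<open>g\<close> are the two summands of the Stirling
    recurrence. The index shift here is free because \<open>h 0 = 0\<close>; in the next step the
    top term drops out because \<open>Stirling j (Suc j) = 0\<close>.\<close>
  also have "\<dots> = (\<Sum>i\<le>Suc j. h i) + (\<Sum>i\<le>j. g i)"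
    by (subst sum.atMost_Suc_shift) (simp add: h_def sum.distrib)
  also have "\<dots> = (\<Sum>i\<le>j. h i + g i)"
    by (simp add: h_def sum.distrib)
  also have "\<dots> = (\<Sum>i\<le>j. k * ((-2) ^ (j - i) * of_nat (Stirling j i) * chi_moment i k))"
    by (intro sum.cong) (auto simp: h_def g_def chi_moment_Suc Suc_diff_le algebra_simps)
  also have "\<dots> = k ^ Suc j"
    by (simp add: Suc.IH flip: sum_distrib_left)
  finally show ?case .
qed

lemma meval_chi_form:
  "meval (chi_form j) v = (\<Sum>i\<le>j. (-2) ^ (j - i) * of_nat (Stirling j i) * v $ i)"
  by (simp add: chi_form_def atLeast0AtMost)

text \<open>The affine cone over the moment curve. The scale \<open>c\<close> may be 0, which keeps
  the parametrisation polynomial on the whole plane of pairs \<open>(c, k)\<close>.\<close>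

definition chi_cone :: "nat \<Rightarrow> complex \<Rightarrow> complex \<Rightarrow> complex vec" where
  "chi_cone d c k = c \<cdot>\<^sub>v vec (d + 1) (\<lambda>i. chi_moment i k)"

lemma meval_chi_form_cone: "j \<le> d \<Longrightarrow> meval (chi_form j) (chi_cone d c k) = c * k ^ j"
  unfolding meval_chi_form sum_Stirling_chi_moment[of j k, symmetric] sum_distrib_left
  by (intro sum.cong) (auto simp: chi_cone_def)

lemma mpoly_ring_chi_form: "j \<le> d \<Longrightarrow> chi_form j \<in> carrier (mpoly_ring d)"
  unfolding chi_form_def by (intro mpoly_ring_sum mpoly_ring_mult mpoly_ring_var) auto

lemma homogeneous_of_chi_form: "homogeneous_of 1 (chi_form j)"
  unfolding chi_form_def
  by (intro homogeneous_of_sum)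
    (use homogeneous_of_mult[OF homogeneous_of_const homogeneous_of_var] in simp)

lemma two_minors_chi_matrix_carrier: "two_minors (chi_matrix d) \<subseteq> carrier (mpoly_ring d)"
  unfolding two_minors_chi_matrix
  by (auto intro!: mpoly_ring_diff mpoly_ring_mult mpoly_ring_chi_form)

lemma two_minors_chi_matrix_homogeneous:
  "f \<in> two_minors (chi_matrix d) \<Longrightarrow> homogeneous f"
  unfolding two_minors_chi_matrix homogeneous_iff
  by (auto intro!: exI homogeneous_of_diff homogeneous_of_mult homogeneous_of_chi_form)

section \<open>Ideals of the polynomial ring\<close>

lemma ideal_mpoly_ringI:
  assumes "I \<subseteq> carrier (mpoly_ring d)" "0 \<in> I"
    and "\<And>f g. f \<in> I \<Longrightarrow> g \<in> I \<Longrightarrow> f + g \<in> I"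
    and "\<And>f g. f \<in> carrier (mpoly_ring d) \<Longrightarrow> g \<in> I \<Longrightarrow> f * g \<in> I"
  shows "ideal I (mpoly_ring d)"
proof -
  interpret cring "mpoly_ring d" by (rule cring_mpoly_ring)
  \<comment> \<open>Negation is multiplication by the ring element -1.\<close>
  have uminus: "- f \<in> I" if "f \<in> I" for f
    using assms(4)[OF mpoly_ring_uminus[OF mpoly_ring_one] that] by simp
  show ?thesis
  proof (rule idealI)
    show "subgroup I (add_monoid (mpoly_ring d))"
    proof (rule add.subgroupI)
      fix f assume f: "f \<in> I"
      then have "\<ominus>\<^bsub>mpoly_ring d\<^esub> f = - f"
        using assms(1) by (intro minus_equality) (auto intro: mpoly_ring_uminus)
      then show "\<ominus>\<^bsub>mpoly_ring d\<^esub> f \<in> I" using uminus[OF f] by simp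
    next
      show "I \<noteq> {}" using assms(2) by blast
      show "f \<oplus>\<^bsub>mpoly_ring d\<^esub> g \<in> I" if "f \<in> I" "g \<in> I" for f g
        using assms(3)[OF that] by simp
    qed (rule assms(1))
    show "f \<otimes>\<^bsub>mpoly_ring d\<^esub> g \<in> I" if "f \<in> I" "g \<in> carrier (mpoly_ring d)" for f g
      using assms(4)[OF that(2,1)] by (simp add: mult.commute[of f g])
    show "g \<otimes>\<^bsub>mpoly_ring d\<^esub> f \<in> I" if "f \<in> I" "g \<in> carrier (mpoly_ring d)" for f g
      using assms(4)[OF that(2,1)] by simp
  qed (rule ring_axioms)
qed

context
  fixes d :: nat and I
  assumes I: "ideal I (mpoly_ring d)"
begin

lemma mpoly_ideal_zero: "0 \<in> I"
  using additive_subgroup.zero_closed[OF ideal.axioms(1)[OF I]] by simp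

lemma mpoly_ideal_add: "f \<in> I \<Longrightarrow> g \<in> I \<Longrightarrow> f + g \<in> I"
  using additive_subgroup.a_closed[OF ideal.axioms(1)[OF I]] by simp

lemma mpoly_ideal_mult: "f \<in> carrier (mpoly_ring d) \<Longrightarrow> g \<in> I \<Longrightarrow> f * g \<in> I"
  using ideal.I_l_closed[OF I] by simp

lemma mpoly_ideal_uminus: "f \<in> I \<Longrightarrow> - f \<in> I"
  using mpoly_ideal_mult[OF mpoly_ring_uminus[OF mpoly_ring_one], of f] by simp

end

lemma ideal_vanishing:
  "ideal {f \<in> carrier (mpoly_ring d). \<forall>v\<in>V. meval f v = 0} (mpoly_ring d)"
  by (rule ideal_mpoly_ringI) (simp_all add: mpoly_ring_add mpoly_ring_mult subset_iff)

section \<open>Straightening modulo the minors\<close>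

definition chi_ideal :: "nat \<Rightarrow> mpoly set" where
  "chi_ideal d = Idl\<^bsub>mpoly_ring d\<^esub> (two_minors (chi_matrix d))"

lemma ideal_chi_ideal: "ideal (chi_ideal d) (mpoly_ring d)"
proof -
  interpret cring "mpoly_ring d" by (rule cring_mpoly_ring)
  show ?thesis
    unfolding chi_ideal_def by (rule genideal_ideal[OF two_minors_chi_matrix_carrier])
qed

lemma two_minors_subset_chi_ideal: "two_minors (chi_matrix d) \<subseteq> chi_ideal d"
proof -
  interpret cring "mpoly_ring d" by (rule cring_mpoly_ring)
  show ?thesis
    unfolding chi_ideal_def by (rule genideal_self[OF two_minors_chi_matrix_carrier])
qed

lemma chi_ideal_minimal:
  assumes "ideal J (mpoly_ring d)" "two_minors (chi_matrix d) \<subseteq> J"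
  shows "chi_ideal d \<subseteq> J"
proof -
  interpret cring "mpoly_ring d" by (rule cring_mpoly_ring)
  show ?thesis
    unfolding chi_ideal_def by (rule genideal_minimal[OF assms])
qed

lemma chi_ideal_carrier: "chi_ideal d \<subseteq> carrier (mpoly_ring d)"
  using additive_subgroup.a_subset[OF ideal.axioms(1)[OF ideal_chi_ideal]] .

text \<open>The polynomials vanishing at one fixed vector form an ideal, so it suffices to test the
  generators.\<close>

lemma meval_chi_ideal:
  assumes "f \<in> chi_ideal d" "\<And>g. g \<in> two_minors (chi_matrix d) \<Longrightarrow> meval g v = 0"
  shows "meval f v = 0"
proof -
  have "chi_ideal d \<subseteq> {f \<in> carrier (mpoly_ring d). \<forall>w\<in>{v}. meval f w = 0}"
    using assms(2) two_minors_chi_matrix_carrier by (intro chi_ideal_minimal ideal_vanishing) auto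
  then show ?thesis using assms(1) by blast
qed

section \<open>Congruence modulo the minors and standard monomials\<close>

definition chi_cong :: "nat \<Rightarrow> mpoly \<Rightarrow> mpoly \<Rightarrow> bool" where
  "chi_cong d f g \<longleftrightarrow> f - g \<in> chi_ideal d"

lemma chi_cong_refl [simp]: "chi_cong d f f"
  by (simp add: chi_cong_def mpoly_ideal_zero[OF ideal_chi_ideal])

lemma chi_cong_trans [trans]: "chi_cong d f g \<Longrightarrow> chi_cong d g h \<Longrightarrow> chi_cong d f h"
  using mpoly_ideal_add[OF ideal_chi_ideal, of "f - g" d "g - h"] by (simp add: chi_cong_def)

lemma chi_cong_add: "chi_cong d f g \<Longrightarrow> chi_cong d f' g' \<Longrightarrow> chi_cong d (f + f') (g + g')"
  using mpoly_ideal_add[OF ideal_chi_ideal, of "f - g" d "f' - g'"]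
  by (simp add: chi_cong_def algebra_simps)

lemma chi_cong_mult:
  "h \<in> carrier (mpoly_ring d) \<Longrightarrow> chi_cong d f g \<Longrightarrow> chi_cong d (h * f) (h * g)"
  using mpoly_ideal_mult[OF ideal_chi_ideal, of h d "f - g"]
  by (simp add: chi_cong_def algebra_simps)

text \<open>A minor moves one unit of index from the smaller factor to the larger one. Repeating
  this spreads the pair until the smaller index reaches 0 or the larger one reaches
  \<open>d\<close>.\<close>

lemma chi_form_exchange:
  assumes "a \<le> b" "b \<le> d"
  shows "chi_cong d (chi_form a * chi_form b)
    (chi_form (min (a + b) d) * chi_form (a + b - min (a + b) d))"
  using assms
proof (induction a arbitrary: b)
  case 0
  then show ?case by (simp add: mult.commute)
next
  case (Suc a)
  show ?case
  proof (cases "b = d")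
    case True
    then show ?thesis by (simp add: mult.commute)
  next
    case False
    then have "chi_form a * chi_form (Suc b) - chi_form b * chi_form (Suc a)
        \<in> two_minors (chi_matrix d)"
      using Suc.prems by (fastforce simp: two_minors_chi_matrix)
    then have "- (chi_form a * chi_form (Suc b) - chi_form b * chi_form (Suc a)) \<in> chi_ideal d"
      using two_minors_subset_chi_ideal by (intro mpoly_ideal_uminus[OF ideal_chi_ideal]) auto
    then have "chi_cong d (chi_form (Suc a) * chi_form b) (chi_form a * chi_form (Suc b))"
      by (simp add: chi_cong_def mult.commute)
    also have "chi_cong d (chi_form a * chi_form (Suc b))
        (chi_form (min (a + Suc b) d) * chi_form (a + Suc b - min (a + Suc b) d))"
      using Suc False by (intro Suc.IH) auto
    finally show ?thesis by simp
  qed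
qed

text \<open>
  The standard monomial of degree \<open>n\<close> and weight \<open>w\<close>: a product of \<open>n\<close> of the forms
  \<open>y\<^sub>j\<close>, chosen greedily with largest possible index, whose indices sum to \<open>w\<close>.
  It is meaningful only for \<open>w \<le> n * d\<close>.
\<close>

fun chi_std :: "nat \<Rightarrow> nat \<Rightarrow> nat \<Rightarrow> mpoly" where
  "chi_std d 0 w = 1"
| "chi_std d (Suc n) w = chi_form (min w d) * chi_std d n (w - min w d)"

lemma mpoly_ring_chi_std: "chi_std d n w \<in> carrier (mpoly_ring d)"
  by (induction n arbitrary: w) (simp_all add: mpoly_ring_mult mpoly_ring_chi_form)

lemma meval_chi_std: "w \<le> n * d \<Longrightarrow> meval (chi_std d n w) (chi_cone d c k) = c ^ n * k ^ w"
proof (induction n arbitrary: w)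
  case (Suc n)
  then have "meval (chi_std d n (w - min w d)) (chi_cone d c k) = c ^ n * k ^ (w - min w d)"
    by (intro Suc.IH) (auto simp: min_def)
  then show ?case
    by (simp add: meval_chi_form_cone flip: power_add)
qed simp

text \<open>Exchanging the new factor with the leading one makes the leading index as large as
  possible; the leftover factor is absorbed by the remaining \<open>n\<close> factors through the
  induction hypothesis.\<close>

lemma chi_form_times_std:
  assumes "j \<le> d" "w \<le> n * d"
  shows "chi_cong d (chi_form j * chi_std d n w) (chi_std d (Suc n) (j + w))"
  using assms
proof (induction n arbitrary: j w)
  case 0
  then show ?case by simp
next
  case (Suc n)
  \<comment> \<open>\<open>a\<close> is the leading index of the standard monomial before the
    exchange, \<open>b\<close> the leading index after it, and \<open>j + a - b\<close> the index
    left over.\<close>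
  define a where "a = min w d"
  define b where "b = min (j + a) d"
  have "chi_cong d (chi_form j * chi_form a) (chi_form b * chi_form (j + a - b))"
    using Suc.prems chi_form_exchange[of j a d] chi_form_exchange[of a j d]
    unfolding b_def by (cases "j \<le> a") (auto simp: a_def mult.commute add.commute)
  then have "chi_cong d (chi_std d n (w - a) * (chi_form j * chi_form a))
      (chi_std d n (w - a) * (chi_form b * chi_form (j + a - b)))"
    by (intro chi_cong_mult mpoly_ring_chi_std)
  then have "chi_cong d (chi_form j * chi_std d (Suc n) w)
      (chi_form b * (chi_form (j + a - b) * chi_std d n (w - a)))"
    by (simp add: a_def mult_ac)
  also have "chi_cong d \<dots> (chi_form b * chi_std d (Suc n) (j + a - b + (w - a)))"
    using Suc.prems by (intro chi_cong_mult mpoly_ring_chi_form Suc.IH) (auto simp: a_def b_def min_def)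
  also have "chi_form b * chi_std d (Suc n) (j + a - b + (w - a)) = chi_std d (Suc (Suc n)) (j + w)"
  proof -
    \<comment> \<open>If \<open>w\<close> exceeds \<open>d\<close>, then \<open>a = d\<close> and
      both minima equal \<open>d\<close>. The truncated subtractions are exact because
      \<open>b\<close> is at most \<open>j + a\<close> and \<open>a\<close> is at most
      \<open>w\<close>.\<close>
    have "b = min (j + w) d" "j + a - b + (w - a) = j + w - b"
      using Suc.prems by (auto simp: a_def b_def min_def)
    then show ?thesis by (simp only: chi_std.simps(2)[of d "Suc n"])
  qed
  finally show ?case .
qed

section \<open>Normal forms: linear combinations of standard monomials\<close>

definition chi_sum :: "nat \<Rightarrow> nat \<Rightarrow> (nat \<Rightarrow> nat \<Rightarrow> complex) \<Rightarrow> mpoly" where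
  "chi_sum d N a = (\<Sum>n<N. \<Sum>w\<le>n * d. mconst (a n w) * chi_std d n w)"

text \<open>Quantifying over all large \<open>N\<close> spares a comparison of summation bounds in sums.\<close>

definition chi_normal :: "nat \<Rightarrow> mpoly \<Rightarrow> bool" where
  "chi_normal d f \<longleftrightarrow> (\<exists>N\<^sub>0 a. \<forall>N\<ge>N\<^sub>0. chi_cong d f (chi_sum d N a))"

lemma mconst_zero [simp]: "mconst 0 = 0"
  by (simp add: mconst_def)

lemma mconst_one [simp]: "mconst 1 = 1"
  by (simp add: mconst_def)

lemma mconst_add: "mconst (a + b) = mconst a + mconst b"
  by (simp add: mconst_def single_add)

lemma mconst_mult: "mconst (a * b) = mconst a * mconst b"
  by (simp add: mconst_def mult_single)

lemma chi_normal_cong: "chi_cong d f g \<Longrightarrow> chi_normal d g \<Longrightarrow> chi_normal d f"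
  unfolding chi_normal_def by (meson chi_cong_trans)

lemma chi_normal_add:
  assumes "chi_normal d f" "chi_normal d g"
  shows "chi_normal d (f + g)"
proof -
  obtain N\<^sub>1 a where a: "\<And>N. N \<ge> N\<^sub>1 \<Longrightarrow> chi_cong d f (chi_sum d N a)"
    using assms(1) unfolding chi_normal_def by blast
  obtain N\<^sub>2 b where b: "\<And>N. N \<ge> N\<^sub>2 \<Longrightarrow> chi_cong d g (chi_sum d N b)"
    using assms(2) unfolding chi_normal_def by blast
  have "chi_cong d (f + g) (chi_sum d N (\<lambda>n w. a n w + b n w))" if "N \<ge> max N\<^sub>1 N\<^sub>2" for N
    using chi_cong_add[OF a b, of N N] that
    by (simp add: chi_sum_def mconst_add distrib_right sum.distrib)
  then show ?thesis unfolding chi_normal_def by blast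
qed

lemma chi_normal_std:
  assumes "w \<le> n * d"
  shows "chi_normal d (mconst c * chi_std d n w)"
proof -
  \<comment> \<open>Nested conditionals let the sums over weights and over degrees collapse one
    after the other. The bound \<open>Suc n\<close> below is the first one whose range of degrees
    includes \<open>n\<close>.\<close>
  define a where "a n' w' = (if n' = n then if w' = w then c else 0 else 0)" for n' w'
  have "chi_sum d N a = mconst c * chi_std d n w" if "N \<ge> Suc n" for N
  proof -
    have "(\<Sum>w'\<le>n' * d. mconst (a n' w') * chi_std d n' w')
        = (if n' = n then mconst c * chi_std d n w else 0)" for n'
    proof -
      have "mconst (a n w') * chi_std d n w' = (if w' = w then mconst c * chi_std d n w else 0)" for w'
        by (simp add: a_def)
      then show ?thesis using assms by (simp add: a_def)
    qed
    then show ?thesis using that by (simp add: chi_sum_def)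
  qed
  then show ?thesis unfolding chi_normal_def by (metis chi_cong_refl)
qed

lemma chi_normal_sum: "(\<And>x. x \<in> A \<Longrightarrow> chi_normal d (f x)) \<Longrightarrow> chi_normal d (sum f A)"
proof (induction A rule: infinite_finite_induct)
  case (insert x A)
  then show ?case by (simp add: chi_normal_add)
qed (use chi_normal_std[of 0 0 d 0] in simp_all)

lemma chi_normal_const: "chi_normal d (mconst c)"
  using chi_normal_std[of 0 0 d c] by simp

lemma chi_normal_const_mult:
  assumes "chi_normal d f"
  shows "chi_normal d (mconst c * f)"
proof -
  obtain N a where "chi_cong d f (chi_sum d N a)"
    using assms unfolding chi_normal_def by blast
  then have "chi_cong d (mconst c * f) (mconst c * chi_sum d N a)"
    by (intro chi_cong_mult) auto
  also have "mconst c * chi_sum d N a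
      = (\<Sum>n<N. \<Sum>w\<le>n * d. mconst (c * a n w) * chi_std d n w)"
    by (simp add: chi_sum_def sum_distrib_left mconst_mult mult.assoc)
  finally show ?thesis
    by (rule chi_normal_cong) (intro chi_normal_sum chi_normal_std; simp)
qed

lemma chi_normal_form_mult:
  assumes "chi_normal d f" "j \<le> d"
  shows "chi_normal d (chi_form j * f)"
proof -
  obtain N a where "chi_cong d f (chi_sum d N a)"
    using assms unfolding chi_normal_def by blast
  then have "chi_cong d (chi_form j * f) (chi_form j * chi_sum d N a)"
    using assms(2) by (intro chi_cong_mult mpoly_ring_chi_form)
  also have "chi_form j * chi_sum d N a
      = (\<Sum>n<N. \<Sum>w\<le>n * d. mconst (a n w) * (chi_form j * chi_std d n w))"
    by (simp add: chi_sum_def sum_distrib_left mult_ac)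
  finally show ?thesis
  proof (rule chi_normal_cong, intro chi_normal_sum)
    fix n w assume "w \<in> {..n * d}"
    then have "chi_cong d (mconst (a n w) * (chi_form j * chi_std d n w))
        (mconst (a n w) * chi_std d (Suc n) (j + w))"
      using assms(2) by (intro chi_cong_mult chi_form_times_std) auto
    moreover have "chi_normal d (mconst (a n w) * chi_std d (Suc n) (j + w))"
      using assms(2) \<open>w \<in> {..n * d}\<close> by (intro chi_normal_std) auto
    ultimately show "chi_normal d (mconst (a n w) * (chi_form j * chi_std d n w))"
      by (rule chi_normal_cong)
  qed
qed

text \<open>The forms are unitriangular in the variables, so \<open>mvar i\<close> is
  \<open>chi_form i\<close> minus a combination of variables of smaller index. This permits strong
  induction on \<open>i\<close>.\<close>

lemma chi_normal_var_mult:
  assumes "chi_normal d f" "i \<le> d"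
  shows "chi_normal d (mvar i * f)"
  using assms(2)
proof (induction i rule: less_induct)
  case (less i)
  define c where "c l = (-2) ^ (i - l) * (of_nat (Stirling i l) :: complex)" for l
  \<comment> \<open>The leading coefficient is 1, since \<open>Stirling i i = 1\<close> and the
    power of -2 has exponent 0.\<close>
  have "chi_form i = (\<Sum>l<i. mconst (c l) * mvar l) + mvar i"
    by (simp add: chi_form_def c_def atLeast0AtMost lessThan_Suc_atMost[symmetric])
  then have "mvar i * f = chi_form i * f + (\<Sum>l<i. mconst (- c l) * (mvar l * f))"
    by (simp add: algebra_simps sum_distrib_left mconst_def single_uminus sum_negf)
  moreover have "chi_normal d (mconst (- c l) * (mvar l * f))" if "l < i" for l
    using less that by (intro chi_normal_const_mult less.IH) auto
  ultimately show ?case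
    using less.prems assms(1)
    by (auto intro!: chi_normal_add chi_normal_sum chi_normal_form_mult)
qed

lemma chi_normal: "f \<in> carrier (mpoly_ring d) \<Longrightarrow> chi_normal d f"
  by (induction rule: mpoly_ring_induct)
    (auto intro: chi_normal_const chi_normal_add chi_normal_var_mult)

section \<open>Linear independence and the membership criterion\<close>

lemma power_sum_zero_imp_coeff_zero:
  fixes b :: "nat \<Rightarrow> complex"
  assumes "\<And>c. c \<noteq> 0 \<Longrightarrow> (\<Sum>n<N. b n * c ^ n) = 0" "n < N"
  shows "b n = 0"
proof -
  \<comment> \<open>Shifting the coefficients by one multiplies the sum by \<open>c\<close>. It then
    vanishes at \<open>c = 0\<close> too, where nothing is assumed, and is the zero
    polynomial.\<close>
  define b' where "b' = case_nat 0 b"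
  have "(\<Sum>i\<le>N. b' i * c ^ i) = c * (\<Sum>n<N. b n * c ^ n)" for c
    unfolding lessThan_Suc_atMost[symmetric] sum.lessThan_Suc_shift
    by (simp add: b'_def sum_distrib_left mult_ac)
  then have "\<forall>c. (\<Sum>i\<le>N. b' i * c ^ i) = 0"
    using assms(1) by (metis mult_eq_0_iff)
  then have "\<forall>i\<le>N. b' i = 0" by (simp add: polyfun_eq_0)
  then show ?thesis using assms(2) unfolding b'_def
    by (metis Suc_leI old.nat.simps(5))
qed

text \<open>This criterion turns statements about the ideal into statements about functions of
  \<open>(c, k)\<close>; primality, the Zariski closure and the vanishing ideal are all derived from
  it.\<close>

lemma mem_chi_ideal_iff:
  "f \<in> chi_ideal d \<longleftrightarrow>
    f \<in> carrier (mpoly_ring d) \<and> (\<forall>c k. c \<noteq> 0 \<longrightarrow> meval f (chi_cone d c k) = 0)"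
proof
  \<comment> \<open>On the cone, both products in the minor of columns \<open>a\<close> and
    \<open>b\<close> take the value \<open>c ^ 2 * k ^ (a + b + 1)\<close>.\<close>
  have vanish: "meval f (chi_cone d c k) = 0" if "f \<in> chi_ideal d" for f c k
    using that
    by (rule meval_chi_ideal)
      (auto simp: two_minors_chi_matrix meval_chi_form_cone)
  {
    assume "f \<in> chi_ideal d"
    then show "f \<in> carrier (mpoly_ring d) \<and> (\<forall>c k. c \<noteq> 0 \<longrightarrow> meval f (chi_cone d c k) = 0)"
      using vanish chi_ideal_carrier by blast
  }
  assume f: "f \<in> carrier (mpoly_ring d) \<and> (\<forall>c k. c \<noteq> 0 \<longrightarrow> meval f (chi_cone d c k) = 0)"
  then obtain N a where a: "chi_cong d f (chi_sum d N a)"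
    using chi_normal unfolding chi_normal_def by blast
  have coeff: "a n w = 0" if "n < N" "w \<le> n * d" for n w
  proof -
    \<comment> \<open>Independence is used twice: for fixed \<open>k\<close> as a polynomial in
      \<open>c\<close>, and then for each of its coefficients as a polynomial in
      \<open>k\<close>.\<close>
    have "(\<Sum>n<N. (\<Sum>w\<le>n * d. a n w * k ^ w) * c ^ n) = 0" if "c \<noteq> 0" for c k
    proof -
      have "meval (chi_sum d N a) (chi_cone d c k) = 0"
        using vanish[OF a[unfolded chi_cong_def]] f that by simp
      then show ?thesis
        by (simp add: chi_sum_def meval_chi_std sum_distrib_left sum_distrib_right mult_ac)
    qed
    then have "(\<Sum>w\<le>n * d. a n w * k ^ w) = 0" for k
      using \<open>n < N\<close> by (rule power_sum_zero_imp_coeff_zero)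
    then have "\<forall>w\<le>n * d. a n w = 0" using polyfun_eq_0 by blast
    then show ?thesis using \<open>w \<le> n * d\<close> by blast
  qed
  then have "chi_sum d N a = 0" by (simp add: chi_sum_def)
  then show "f \<in> chi_ideal d" using a by (simp add: chi_cong_def)
qed

section \<open>The moment variety\<close>

lemma meval_polynomial_curve:
  assumes "f \<in> carrier (mpoly_ring d)"
  shows "\<exists>p. \<forall>t. meval f (vec (d + 1) (\<lambda>i. poly (q i) t)) = poly p t"
  using assms
proof (induction rule: mpoly_ring_induct)
  case (const c)
  then show ?case by (intro exI[of _ "[:c:]"]) simp
next
  case (add f g)
  then obtain p p' where "\<forall>t. meval f (vec (d + 1) (\<lambda>i. poly (q i) t)) = poly p t"
    "\<forall>t. meval g (vec (d + 1) (\<lambda>i. poly (q i) t)) = poly p' t" by blast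
  then show ?case by (intro exI[of _ "p + p'"]) simp
next
  case (var i f)
  then obtain p where "\<forall>t. meval f (vec (d + 1) (\<lambda>i. poly (q i) t)) = poly p t" by blast
  then show ?case using var by (intro exI[of _ "q i * p"]) simp
qed

lemma meval_chi_cone_line:
  assumes "f \<in> carrier (mpoly_ring d)"
  obtains p where "\<And>t. meval f (chi_cone d (poly c t) (poly k t)) = poly p t"
proof -
  \<comment> \<open>The coordinates of the cone point, computed in the polynomial ring with the
    polynomials \<open>c\<close> and \<open>k\<close> in place of numbers.\<close>
  define q where "q i = c * (\<Prod>j<i. k + of_nat (2 * j))" for i
  have "chi_cone d (poly c t) (poly k t) = vec (d + 1) (\<lambda>i. poly (q i) t)" for t
    by (rule eq_vecI) (simp_all add: chi_cone_def chi_moment_def q_def poly_prod of_nat_poly)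
  then show ?thesis using that meval_polynomial_curve[OF assms, of q] by auto
qed

text \<open>
  Two polynomials not in the ideal have nonzero values at points \<open>(c\<^sub>1, k\<^sub>1)\<close> and
  \<open>(c\<^sub>2, k\<^sub>2)\<close> of the parameter plane; restriction to the line joining these reduces
  primality to the absence of zero divisors among univariate polynomials.
\<close>

lemma primeideal_chi_ideal: "primeideal (chi_ideal d) (mpoly_ring d)"
proof (rule primeidealI)
  show "carrier (mpoly_ring d) \<noteq> chi_ideal d"
  proof
    assume "carrier (mpoly_ring d) = chi_ideal d"
    then have "1 \<in> chi_ideal d" by (metis mpoly_ring_one)
    then have "meval 1 (chi_cone d 1 0) = 0"
      unfolding mem_chi_ideal_iff using one_neq_zero by blast
    then show False by simp
  qed
next
  fix f g
  assume f: "f \<in> carrier (mpoly_ring d)" and g: "g \<in> carrier (mpoly_ring d)"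
    and "f \<otimes>\<^bsub>mpoly_ring d\<^esub> g \<in> chi_ideal d"
  then have fg: "meval f (chi_cone d c k) * meval g (chi_cone d c k) = 0" if "c \<noteq> 0" for c k
    using that by (simp add: mem_chi_ideal_iff)
  show "f \<in> chi_ideal d \<or> g \<in> chi_ideal d"
  proof (rule ccontr)
    assume "\<not> ?thesis"
    then obtain c\<^sub>1 k\<^sub>1 c\<^sub>2 k\<^sub>2 where
      1: "c\<^sub>1 \<noteq> 0" "meval f (chi_cone d c\<^sub>1 k\<^sub>1) \<noteq> 0" and
      2: "c\<^sub>2 \<noteq> 0" "meval g (chi_cone d c\<^sub>2 k\<^sub>2) \<noteq> 0"
      using f g by (auto simp: mem_chi_ideal_iff)
    \<comment> \<open>The line passes through the first parameter pair at \<open>t = 0\<close> and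
      through the second at \<open>t = 1\<close>.\<close>
    define c k where "c = [:c\<^sub>1, c\<^sub>2 - c\<^sub>1:]" and "k = [:k\<^sub>1, k\<^sub>2 - k\<^sub>1:]"
    obtain p where p: "\<And>t. meval f (chi_cone d (poly c t) (poly k t)) = poly p t"
      using meval_chi_cone_line[OF f] by blast
    obtain q where q: "\<And>t. meval g (chi_cone d (poly c t) (poly k t)) = poly q t"
      using meval_chi_cone_line[OF g] by blast
    \<comment> \<open>The product is known to vanish only for nonzero scale; the extra factor
      \<open>c\<close> covers the parameters \<open>t\<close> at which the line meets scale
      0.\<close>
    have "poly (c * p * q) t = 0" for t
      using fg[of "poly c t" "poly k t"] by (auto simp: p q)
    then have "c * p * q = 0" using poly_all_0_iff_0 by blast
    moreover have "poly c 0 \<noteq> 0" using 1 by (simp add: c_def)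
    moreover have "poly p 0 \<noteq> 0" using 1 by (simp add: c_def k_def flip: p)
    moreover have "poly q 1 \<noteq> 0" using 2 by (simp add: c_def k_def flip: q)
    ultimately show False by (metis mult_eq_0_iff poly_0)
  qed
qed (rule ideal_chi_ideal cring_mpoly_ring)+

section \<open>The closure of the moment curve and its vanishing ideal\<close>

abbreviation chi_point :: "nat \<Rightarrow> complex \<Rightarrow> complex vec set" where
  "chi_point d k \<equiv> proj_point (vec (d + 1) (\<lambda>i. chi_moment i k))"

lemma vanishing_on_chi_point:
  "(\<forall>v\<in>chi_point d k. meval f v = 0) \<longleftrightarrow> (\<forall>c. c \<noteq> 0 \<longrightarrow> meval f (chi_cone d c k) = 0)"
  unfolding proj_point_def chi_cone_def by blast

lemma chi_point_in_proj_space: "chi_point d k \<in> proj_space d"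
proof -
  have "vec (d + 1) (\<lambda>i. chi_moment i k) $ 0 \<noteq> 0\<^sub>v (d + 1) $ 0"
    by (simp add: chi_moment_def)
  then have "vec (d + 1) (\<lambda>i. chi_moment i k) \<noteq> 0\<^sub>v (d + 1)" by metis
  then show ?thesis unfolding proj_space_def by (intro imageI) auto
qed

lemma chi_point_in_zero_locus:
  "chi_point d k \<in> zero_locus d S \<longleftrightarrow> (\<forall>f\<in>S. \<forall>c. c \<noteq> 0 \<longrightarrow> meval f (chi_cone d c k) = 0)"
  unfolding zero_locus_def mem_Collect_eq vanishing_on_chi_point
  by (simp only: chi_point_in_proj_space simp_thms)

text \<open>\<open>zariski_closed\<close> asks for homogeneous equations. The ideal may contain
  inhomogeneous elements, whereas its generators are homogeneous.\<close>

lemma zero_locus_chi_ideal: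
  "zero_locus d (chi_ideal d) = zero_locus d (two_minors (chi_matrix d))"
proof
  show "zero_locus d (chi_ideal d) \<subseteq> zero_locus d (two_minors (chi_matrix d))"
    using two_minors_subset_chi_ideal unfolding zero_locus_def by blast
  show "zero_locus d (two_minors (chi_matrix d)) \<subseteq> zero_locus d (chi_ideal d)"
  proof
    fix P assume P: "P \<in> zero_locus d (two_minors (chi_matrix d))"
    have "meval f v = 0" if "f \<in> chi_ideal d" "v \<in> P" for f v
      using that(1) by (rule meval_chi_ideal) (use P that(2) in \<open>simp add: zero_locus_def\<close>)
    then show "P \<in> zero_locus d (chi_ideal d)" using P by (simp add: zero_locus_def)
  qed
qed

text \<open>By the membership criterion, the equations of any closed set containing the moment curve
  lie in the ideal; hence the zero locus of the ideal is the smallest such set.\<close>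

lemma subset_chi_ideal_iff:
  assumes "S \<subseteq> carrier (mpoly_ring d)"
  shows "S \<subseteq> chi_ideal d \<longleftrightarrow> range (chi_point d) \<subseteq> zero_locus d S"
proof -
  have "range (chi_point d) \<subseteq> zero_locus d S \<longleftrightarrow> (\<forall>k. chi_point d k \<in> zero_locus d S)"
    by blast
  then show ?thesis
    using assms unfolding chi_point_in_zero_locus subset_iff[of S] mem_chi_ideal_iff by simp blast
qed

lemma chi_moment_variety_eq: "chi_moment_variety d = zero_locus d (chi_ideal d)"
proof -
  have "range (chi_point d) \<subseteq> zero_locus d (chi_ideal d)"
    by (rule subset_chi_ideal_iff[OF chi_ideal_carrier, THEN iffD1, OF subset_refl])
  moreover have "zariski_closed d (zero_locus d (chi_ideal d))"
    unfolding zariski_closed_def zero_locus_chi_ideal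
    by (intro exI[of _ "two_minors (chi_matrix d)"] conjI ballI refl
        two_minors_chi_matrix_carrier two_minors_chi_matrix_homogeneous)
  moreover have "zero_locus d (chi_ideal d) \<subseteq> Z"
    if "zariski_closed d Z" "range (chi_point d) \<subseteq> Z" for Z
  proof -
    obtain S where S: "S \<subseteq> carrier (mpoly_ring d)" "Z = zero_locus d S"
      using \<open>zariski_closed d Z\<close> unfolding zariski_closed_def by (elim exE conjE)
    have "S \<subseteq> chi_ideal d"
      using that(2) unfolding S(2) by (rule subset_chi_ideal_iff[OF S(1), THEN iffD2])
    then show ?thesis unfolding S(2) zero_locus_def by blast
  qed
  ultimately show ?thesis
    unfolding chi_moment_variety_def zariski_closure_def
    by (intro antisym Inter_lower Inter_greatest) simp_all
qed

lemma vanishing_ideal_chi_moment_variety: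
  "vanishing_ideal d (chi_moment_variety d) = chi_ideal d"
proof
  show "chi_ideal d \<subseteq> vanishing_ideal d (chi_moment_variety d)"
    unfolding vanishing_ideal_def chi_moment_variety_eq zero_locus_def
    using chi_ideal_carrier by blast
  show "vanishing_ideal d (chi_moment_variety d) \<subseteq> chi_ideal d"
  proof
    fix f assume f: "f \<in> vanishing_ideal d (chi_moment_variety d)"
    have "chi_point d k \<in> chi_moment_variety d" for k
      unfolding chi_moment_variety_def zariski_closure_def by blast
    then have "\<forall>v\<in>chi_point d k. meval f v = 0" for k
      using f unfolding vanishing_ideal_def by blast
    then show "f \<in> chi_ideal d"
      using f unfolding vanishing_on_chi_point mem_chi_ideal_iff vanishing_ideal_def by simp
  qed
qed

lemma homogeneous_ideal_chi_ideal: "homogeneous_ideal d (chi_ideal d)"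
proof -
  interpret cring "mpoly_ring d" by (rule cring_mpoly_ring)
  let ?S = "{f \<in> chi_ideal d. homogeneous f}"
  have S: "?S \<subseteq> carrier (mpoly_ring d)" using chi_ideal_carrier by blast
  have "two_minors (chi_matrix d) \<subseteq> ?S"
    using two_minors_subset_chi_ideal two_minors_chi_matrix_homogeneous by blast
  then have "chi_ideal d \<subseteq> Idl\<^bsub>mpoly_ring d\<^esub> ?S"
    using genideal_ideal[OF S] genideal_self[OF S] by (intro chi_ideal_minimal) auto
  moreover have "Idl\<^bsub>mpoly_ring d\<^esub> ?S \<subseteq> chi_ideal d"
    by (rule genideal_minimal[OF ideal_chi_ideal]) blast
  ultimately show ?thesis
    unfolding homogeneous_ideal_def using ideal_chi_ideal by blast
qed

section \<open>The variety as a rational normal curve\<close>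

lemma rank_one_hankel:
  fixes u :: "nat \<Rightarrow> complex"
  assumes minors: "\<And>a b. a < b \<Longrightarrow> b < d \<Longrightarrow> u a * u (Suc b) = u b * u (Suc a)"
    and nonzero: "i \<le> d" "u i \<noteq> 0"
  shows "\<exists>c s t. c \<noteq> 0 \<and> (s, t) \<noteq> (0, 0) \<and> (\<forall>i\<le>d. u i = c * (s ^ (d - i) * t ^ i))"
proof (cases "u 0 = 0")
  case False
  \<comment> \<open>The minor of columns 0 and \<open>i\<close> makes the entries a geometric
    progression with ratio \<open>u 1 / u 0\<close>, which is the curve point with
    \<open>s = 1\<close>.\<close>
  have geometric: "u i = u 0 * (u 1 / u 0) ^ i" if "i \<le> d" for i
    using that
  proof (induction i)
    case (Suc i)
    have "u 0 * u (Suc i) = u i * u 1"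
      using minors[of 0 i] Suc.prems by (cases "i = 0") auto
    then have "u (Suc i) = u i * (u 1 / u 0)" using False by (simp add: field_simps)
    also have "u i = u 0 * (u 1 / u 0) ^ i" using Suc by simp
    finally show ?case by simp
  qed simp
  have curve: "\<forall>i\<le>d. u i = u 0 * (1 ^ (d - i) * (u 1 / u 0) ^ i)"
    unfolding power_one mult_1 using geometric by (intro allI impI)
  show ?thesis
    by (rule exI[of _ "u 0"], rule exI[of _ 1], rule exI[of _ "u 1 / u 0"])
      (intro conjI curve False, simp)
next
  case True
  \<comment> \<open>Adjacent columns express \<open>u (Suc i) ^ 2\<close> as a multiple of
    \<open>u i\<close>, so zeros propagate up to index \<open>d - 1\<close>. Only the last entry
    survives, giving the curve point \<open>s = 0\<close>, \<open>t = 1\<close>.\<close>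
  have zero: "u i = 0" if "i < d" for i
    using that
  proof (induction i)
    case (Suc i)
    then show ?case using minors[of i "Suc i"] by simp
  qed (simp add: True)
  then have ud: "u d \<noteq> 0" using nonzero by (cases "i = d") auto
  have curve: "\<forall>i\<le>d. u i = u d * (0 ^ (d - i) * 1 ^ i)"
    using zero by (auto simp: le_less)
  show ?thesis
    by (rule exI[of _ "u d"], rule exI[of _ 0], rule exI[of _ 1])
      (intro conjI curve ud, simp)
qed

text \<open>The coordinate change from the variables to the forms. Above the diagonal the truncated
  exponent is 0 and the entry vanishes through its Stirling factor.\<close>

definition chi_form_mat :: "nat \<Rightarrow> complex mat" where
  "chi_form_mat d = mat (d + 1) (d + 1) (\<lambda>(j, i). (-2) ^ (j - i) * of_nat (Stirling j i))"

lemma chi_form_mat_carrier: "chi_form_mat d \<in> carrier_mat (d + 1) (d + 1)"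
  by (simp add: chi_form_mat_def)

lemma chi_form_mat_mult_index:
  assumes "v \<in> carrier_vec (d + 1)" "j \<le> d"
  shows "(chi_form_mat d *\<^sub>v v) $ j = meval (chi_form j) v"
proof -
  have "(chi_form_mat d *\<^sub>v v) $ j
      = (\<Sum>i<d + 1. (-2) ^ (j - i) * of_nat (Stirling j i) * v $ i)"
    using assms by (simp add: chi_form_mat_def scalar_prod_def atLeast0LessThan)
  also have "\<dots> = (\<Sum>i\<le>j. (-2) ^ (j - i) * of_nat (Stirling j i) * v $ i)"
    using assms(2) by (intro sum.mono_neutral_right) auto
  finally show ?thesis by (simp add: meval_chi_form)
qed

lemma chi_form_mat_inverse:
  obtains A where "A \<in> carrier_mat (d + 1) (d + 1)" "A * chi_form_mat d = 1\<^sub>m (d + 1)"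
    "chi_form_mat d * A = 1\<^sub>m (d + 1)"
proof -
  have "det (chi_form_mat d) = prod_list (diag_mat (chi_form_mat d))"
    by (rule det_lower_triangular[OF _ chi_form_mat_carrier]) (simp add: chi_form_mat_def)
  also have "\<dots> = 1"
    unfolding prod_list_diag_prod by (simp add: chi_form_mat_def)
  finally have "chi_form_mat d \<in> Units (ring_mat TYPE(complex) (d + 1) ())"
    by (intro det_non_zero_imp_unit[OF chi_form_mat_carrier]) simp
  then show ?thesis using that unfolding Units_def by (auto simp: ring_mat_simps)
qed

lemma proj_point_smult:
  assumes "c \<noteq> 0"
  shows "proj_point (c \<cdot>\<^sub>v v) = proj_point v"
proof -
  have "\<exists>b. a \<cdot>\<^sub>v v = b \<cdot>\<^sub>v (c \<cdot>\<^sub>v v) \<and> b \<noteq> 0" if "a \<noteq> 0" for a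
    using that assms by (intro exI[of _ "a / c"]) (simp add: smult_smult_assoc)
  then show ?thesis
    using assms unfolding proj_point_def by (auto simp: smult_smult_assoc)
qed

lemma proj_point_mult_mat_vec:
  assumes "A \<in> carrier_mat n m" "v \<in> carrier_vec m"
  shows "(\<lambda>v. A *\<^sub>v v) ` proj_point v = proj_point (A *\<^sub>v v)"
proof -
  have "(\<lambda>v. A *\<^sub>v v) ` proj_point v = {A *\<^sub>v (c \<cdot>\<^sub>v v) | c. c \<noteq> 0}"
    unfolding proj_point_def by blast
  then show ?thesis
    by (simp only: mult_mat_vec[OF assms] proj_point_def)
qed

text \<open>In the coordinates given by the forms, the minors cut out exactly the standard curve.
  The inverse \<open>A\<close> of the coordinate change therefore maps the standard curve onto the
  variety.\<close>

lemma rational_normal_curve_chi: "rational_normal_curve d (chi_moment_variety d)"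
proof -
  let ?B = "chi_form_mat d"
  note B = chi_form_mat_carrier[of d]
  obtain A where A: "A \<in> carrier_mat (d + 1) (d + 1)"
    and AB: "A * ?B = 1\<^sub>m (d + 1)" and BA: "?B * A = 1\<^sub>m (d + 1)"
    by (rule chi_form_mat_inverse)
  have AB_vec: "A *\<^sub>v (?B *\<^sub>v v) = v" and BA_vec: "?B *\<^sub>v (A *\<^sub>v v) = v"
    if "v \<in> carrier_vec (d + 1)" for v
    using that AB BA A B by (metis assoc_mult_mat_vec one_mult_mat_vec)+
  have mult_zero_vec: "M *\<^sub>v 0\<^sub>v (d + 1) = 0\<^sub>v (d + 1)"
    if "M \<in> carrier_mat (d + 1) (d + 1)" for M :: "complex mat"
    using that by (intro eq_vecI) auto
  define r where "r s t = vec (d + 1) (\<lambda>i. s ^ (d - i) * t ^ i)" for s t :: complex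
  have r_carrier: "r s t \<in> carrier_vec (d + 1)" for s t by (simp add: r_def)
  have r_nonzero: "r s t \<noteq> 0\<^sub>v (d + 1)" if "(s, t) \<noteq> (0, 0)" for s t
  proof
    assume "r s t = 0\<^sub>v (d + 1)"
    \<comment> \<open>The end coordinates are \<open>s ^ d\<close> and \<open>t ^ d\<close>; for
      \<open>d = 0\<close> the only coordinate is 1.\<close>
    then have "r s t $ 0 = 0" "r s t $ d = 0" by simp_all
    then show False using that by (cases "d = 0") (auto simp: r_def)
  qed
  have std: "standard_rational_normal_curve d = {proj_point (r s t) | s t. (s, t) \<noteq> (0, 0)}"
    by (simp add: standard_rational_normal_curve_def r_def)
  have "P \<in> zero_locus d (two_minors (chi_matrix d))
    \<longleftrightarrow> (\<exists>s t. (s, t) \<noteq> (0, 0) \<and> P = proj_point (A *\<^sub>v r s t))" for P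
  proof
    assume P: "P \<in> zero_locus d (two_minors (chi_matrix d))"
    then obtain v where v: "v \<in> carrier_vec (d + 1)" "v \<noteq> 0\<^sub>v (d + 1)" "P = proj_point v"
      by (auto simp: zero_locus_def proj_space_def)
    then have "v \<in> P" by (auto simp: proj_point_def intro!: exI[of _ 1])
    define u where "u j = meval (chi_form j) v" for j
    \<comment> \<open>Invertibility keeps the image nonzero, which supplies the nonvanishing entry
      required by \<open>rank_one_hankel\<close>.\<close>
    have "?B *\<^sub>v v \<noteq> 0\<^sub>v (d + 1)" using AB_vec[OF v(1)] v(2) mult_zero_vec[OF A] by metis
    moreover have "dim_vec (?B *\<^sub>v v) = d + 1" using B by simp
    ultimately obtain i where i: "i \<le> d" "u i \<noteq> 0"
      using chi_form_mat_mult_index[OF v(1)] unfolding u_def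
      by (metis Suc_eq_plus1 eq_vecI index_zero_vec less_Suc_eq_le)
    have hankel: "u a * u (Suc b) = u b * u (Suc a)" if "a < b" "b < d" for a b
    proof -
      have "meval (chi_form a * chi_form (Suc b) - chi_form b * chi_form (Suc a)) v = 0"
        using P \<open>v \<in> P\<close> that unfolding zero_locus_def two_minors_chi_matrix by blast
      then show ?thesis by (simp add: u_def)
    qed
    obtain c s t where cst: "c \<noteq> 0" "(s, t) \<noteq> (0, 0)"
      "\<And>i. i \<le> d \<Longrightarrow> u i = c * (s ^ (d - i) * t ^ i)"
      using rank_one_hankel[of d u i, OF hankel i] by metis
    have "?B *\<^sub>v v = c \<cdot>\<^sub>v r s t"
      by (rule eq_vecI)
        (use B cst(3) chi_form_mat_mult_index[OF v(1)] in \<open>auto simp: r_def u_def\<close>)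
    then have "v = c \<cdot>\<^sub>v (A *\<^sub>v r s t)"
      using AB_vec[OF v(1)] mult_mat_vec[OF A r_carrier] by simp
    then show "\<exists>s t. (s, t) \<noteq> (0, 0) \<and> P = proj_point (A *\<^sub>v r s t)"
      using cst(1,2) v(3) proj_point_smult by blast
  next
    assume "\<exists>s t. (s, t) \<noteq> (0, 0) \<and> P = proj_point (A *\<^sub>v r s t)"
    then obtain s t where st: "(s, t) \<noteq> (0, 0)" and P: "P = proj_point (A *\<^sub>v r s t)" by blast
    have Ar: "A *\<^sub>v r s t \<in> carrier_vec (d + 1)" using A r_carrier by simp
    have "A *\<^sub>v r s t \<noteq> 0\<^sub>v (d + 1)"
      using BA_vec[OF r_carrier[of s t]] r_nonzero[OF st] mult_zero_vec[OF B] by metis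
    then have "P \<in> proj_space d" using Ar P by (auto simp: proj_space_def)
    moreover have "meval f v = 0" if "f \<in> two_minors (chi_matrix d)" "v \<in> P" for f v
    proof -
      obtain c where v: "v = c \<cdot>\<^sub>v (A *\<^sub>v r s t)" using \<open>v \<in> P\<close> P by (auto simp: proj_point_def)
      then have v_carrier: "v \<in> carrier_vec (d + 1)" using Ar by simp
      have "?B *\<^sub>v v = c \<cdot>\<^sub>v r s t"
        unfolding v mult_mat_vec[OF B Ar] by (simp add: BA_vec[OF r_carrier])
      then have form: "meval (chi_form j) v = c * (s ^ (d - j) * t ^ j)" if "j \<le> d" for j
        using that chi_form_mat_mult_index[OF v_carrier that] by (simp add: r_def)
      obtain a b where ab: "a < b" "b < d"
        and f: "f = chi_form a * chi_form (Suc b) - chi_form b * chi_form (Suc a)"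
        using \<open>f \<in> _\<close> unfolding two_minors_chi_matrix by blast
      \<comment> \<open>Splitting one factor \<open>s\<close> off each of these powers makes the two
        products of the minor identical.\<close>
      have "d - a = Suc (d - Suc a)" "d - b = Suc (d - Suc b)" using ab by auto
      then show ?thesis using ab by (simp add: f form)
    qed
    ultimately show "P \<in> zero_locus d (two_minors (chi_matrix d))"
      by (simp add: zero_locus_def)
  qed
  then have "chi_moment_variety d = {proj_point (A *\<^sub>v r s t) | s t. (s, t) \<noteq> (0, 0)}"
    unfolding chi_moment_variety_eq zero_locus_chi_ideal by blast
  also have "\<dots> = {(\<lambda>v. A *\<^sub>v v) ` proj_point (r s t) | s t. (s, t) \<noteq> (0, 0)}"
    by (simp only: proj_point_mult_mat_vec[OF A r_carrier])
  also have "\<dots> = (\<lambda>P. (\<lambda>v. A *\<^sub>v v) ` P) ` standard_rational_normal_curve d"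
    unfolding std by blast
  finally have "chi_moment_variety d
      = (\<lambda>P. (\<lambda>v. A *\<^sub>v v) ` P) ` standard_rational_normal_curve d" .
  moreover have "invertible_mat A"
    using A B AB BA unfolding invertible_mat_def inverts_mat_def by auto
  moreover have "standard_rational_normal_curve d \<subseteq> proj_space d"
    unfolding std proj_space_def using r_carrier r_nonzero by auto
  moreover have "chi_moment_variety d \<subseteq> proj_space d"
    by (auto simp: chi_moment_variety_eq zero_locus_def)
  ultimately show ?thesis
    unfolding rational_normal_curve_def projectively_equivalent_def using A by blast
qed

theorem proposition4p9:
  fixes d :: nat
  assumes "d \<ge> 2"
  shows "homogeneous_ideal d (vanishing_ideal d (chi_moment_variety d))
    \<and> primeideal (vanishing_ideal d (chi_moment_variety d)) (mpoly_ring d)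
    \<and> vanishing_ideal d (chi_moment_variety d)
        = Idl\<^bsub>mpoly_ring d\<^esub> (two_minors (chi_matrix d))
    \<and> rational_normal_curve d (chi_moment_variety d)"
  unfolding vanishing_ideal_chi_moment_variety
  using homogeneous_ideal_chi_ideal primeideal_chi_ideal rational_normal_curve_chi
  by (simp add: chi_ideal_def)

end
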